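(* Let $\mathcal{M}_1=(E,\mathcal{I}_1)$ be a matroid of rank $r$ with set of bases $\mathcal{X}_1$, let $w:E\to\mathbb{Z}_{\ge0}$, let $o:E\to\{\eta_1,\dots,\eta_K\}$ be an assignment of ordered categories, and let $u\in\mathbb{Z}_{\ge0}^K$ be arbitrary but fixed. Consider the problem $$\text{(A)}\quad \min\, w(B)\quad\text{s.t.}\quad c^{\min}_i(B)\le u_{K-i+1},\ i=1,\dots,K,\quad B\in\mathcal{X}_1,$$ and the matroid intersection problem $$\text{(B)}\quad \min\, w(I)\quad\text{s.t.}\quad I\in\mathcal{I}_1\cap\mathcal{I}_2(u),\quad |I|=\max\{|J|:J\in\mathcal{I}_1\cap\mathcal{I}_2(u)\}.$$ If problem (A) is feasible, then problems (A) and (B) are equivalent, i.e. they have the same feasible set and the same objective function (hence the same optimal solutions). Moreover, if problem (A) is infeasible, then every optimal solution $B^*$ of problem (B) satisfies $|B^*|<r$.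
   Context: Bases of a matroid on a finite ground set $E$ all have the same cardinality $r$ (the rank). For $S\subseteq E$, $w(S)=\sum_{e\in S}w(e)$. $\{\eta_1,\dots,\eta_K\}$ is an ordered set of $K$ categories and $o:E\to\{\eta_1,\dots,\eta_K\}$. For $j=1,\dots,K$ let $E_j=\{e\in E:o(e)=\eta_j\}$, so that $E=E_1\cup\dots\cup E_K$ is a partition of $E$. For a basis $B$ let $c_j(B)=|B\cap E_j|$ and $c^{\min}_j(B)=c_{K-j+1}(B)$. $\mathcal{I}_2(u)=\{J\subseteq E:|J\cap E_j|\le u_j,\ 1\le j\le K\}$ is the family of independent sets of the partition matroid $\mathcal{M}_2(u)=(E,\mathcal{I}_2(u))$. *)

theory Defs
  imports "HOL-Library.FuncSet"
begin

section \<open>Matroids\<close>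

locale matroid =
  fixes E :: "'a set" and indep :: "'a set set"
  assumes finite_ground: "finite E"
    and indep_subset: "indep \<subseteq> Pow E"
    and empty_indep: "{} \<in> indep"
    and indep_hereditary: "Y \<in> indep \<Longrightarrow> X \<subseteq> Y \<Longrightarrow> X \<in> indep"
    and indep_augment:
      "X \<in> indep \<Longrightarrow> Y \<in> indep \<Longrightarrow> card X < card Y \<Longrightarrow> \<exists>e\<in>Y - X. insert e X \<in> indep"

definition bases :: "'a set set \<Rightarrow> 'a set set" where
  "bases \<I> = {B \<in> \<I>. \<forall>X\<in>\<I>. B \<subseteq> X \<longrightarrow> X = B}"

text \<open>The common cardinality of all bases; well defined for matroids by
  \<open>bases_nonempty\<close> and \<open>card_bases_eq\<close> below.\<close>

definition matroid_rank :: "'a set set \<Rightarrow> nat" where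
  "matroid_rank \<I> = (THE r. \<forall>B\<in>bases \<I>. card B = r)"

context matroid
begin

lemma finite_indep: "finite indep"
  using finite_ground indep_subset by (meson finite_Pow_iff finite_subset)

lemma finite_of_indep: "X \<in> indep \<Longrightarrow> finite X"
  using finite_ground indep_subset by (meson PowD finite_subset subsetD)

lemma bases_nonempty: "bases indep \<noteq> {}"
proof -
  obtain B where "B \<in> indep" "\<forall>X\<in>indep. B \<subseteq> X \<longrightarrow> B = X"
    using finite_has_maximal[OF finite_indep] empty_indep by blast
  then show ?thesis
    unfolding bases_def by blast
qed

lemma card_indep_le_basis:
  assumes "B \<in> bases indep" "X \<in> indep"
  shows "card X \<le> card B"
proof (rule ccontr)
  assume "\<not> card X \<le> card B"
  then obtain e where "e \<in> X - B" "insert e B \<in> indep"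
    using indep_augment[of B X] assms by (auto simp: bases_def)
  with assms(1) show False
    unfolding bases_def by blast
qed

lemma card_bases_eq: "B \<in> bases indep \<Longrightarrow> B' \<in> bases indep \<Longrightarrow> card B = card B'"
  using card_indep_le_basis by (simp add: bases_def le_antisym)

lemma card_basis: "B \<in> bases indep \<Longrightarrow> card B = matroid_rank indep"
  unfolding matroid_rank_def
  by (rule the_equality[symmetric]) (auto intro: card_bases_eq)

end

section \<open>Categories\<close>

text \<open>The ordered categories are \<open>\<eta> 1, \<dots>, \<eta> K\<close>, pairwise distinct, and \<open>cat\<close> assigns a
  category to every element of the ground set. All indices run over \<open>{1..K}\<close>.\<close>

definition category_class :: "'a set \<Rightarrow> (nat \<Rightarrow> 'c) \<Rightarrow> ('a \<Rightarrow> 'c) \<Rightarrow> nat \<Rightarrow> 'a set" where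
  "category_class E \<eta> cat j = {e \<in> E. cat e = \<eta> j}"

definition category_count ::
    "'a set \<Rightarrow> (nat \<Rightarrow> 'c) \<Rightarrow> ('a \<Rightarrow> 'c) \<Rightarrow> 'a set \<Rightarrow> nat \<Rightarrow> nat" where
  "category_count E \<eta> cat B j = card (B \<inter> category_class E \<eta> cat j)"

definition category_count_min ::
    "'a set \<Rightarrow> nat \<Rightarrow> (nat \<Rightarrow> 'c) \<Rightarrow> ('a \<Rightarrow> 'c) \<Rightarrow> 'a set \<Rightarrow> nat \<Rightarrow> nat" where
  "category_count_min E K \<eta> cat B j = category_count E \<eta> cat B (K - j + 1)"

definition partition_indep ::
    "'a set \<Rightarrow> nat \<Rightarrow> (nat \<Rightarrow> 'c) \<Rightarrow> ('a \<Rightarrow> 'c) \<Rightarrow> (nat \<Rightarrow> nat) \<Rightarrow> 'a set set" where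
  "partition_indep E K \<eta> cat u =
     {J. J \<subseteq> E \<and> (\<forall>j\<in>{1..K}. card (J \<inter> category_class E \<eta> cat j) \<le> u j)}"

lemma matroid_partition_indep:
  assumes fin: "finite E" and inj: "inj_on \<eta> {1..K}" and cat: "cat \<in> E \<rightarrow> \<eta> ` {1..K}"
  shows "matroid E (partition_indep E K \<eta> cat u)"
proof
  let ?E = "category_class E \<eta> cat"
  show "finite E" by fact
  show "partition_indep E K \<eta> cat u \<subseteq> Pow E"
    by (auto simp: partition_indep_def)
  show "{} \<in> partition_indep E K \<eta> cat u"
    by (simp add: partition_indep_def)
  show "X \<in> partition_indep E K \<eta> cat u"
    if Y: "Y \<in> partition_indep E K \<eta> cat u" and XY: "X \<subseteq> Y" for X Y
  proof -
    have "finite Y"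
      using Y fin by (auto simp: partition_indep_def intro: finite_subset)
    then have "card (X \<inter> ?E j) \<le> card (Y \<inter> ?E j)" for j
      using XY by (intro card_mono) auto
    then show ?thesis
      using Y XY unfolding partition_indep_def by (blast intro: order_trans)
  qed
  show "\<exists>e\<in>Y - X. insert e X \<in> partition_indep E K \<eta> cat u"
    if X: "X \<in> partition_indep E K \<eta> cat u" and Y: "Y \<in> partition_indep E K \<eta> cat u"
      and less: "card X < card Y" for X Y
  proof -
    have disj: "?E i \<inter> ?E j = {}" if "i \<in> {1..K}" "j \<in> {1..K}" "i \<noteq> j" for i j
      using inj_onD[OF inj _ that(1,2)] that(3) unfolding category_class_def by fastforce
    have split: "card Z = (\<Sum>j\<in>{1..K}. card (Z \<inter> ?E j))" if "Z \<subseteq> E" for Z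
    proof -
      have "Z = (\<Union>j\<in>{1..K}. Z \<inter> ?E j)"
      proof (intro equalityI subsetI)
        fix z assume z: "z \<in> Z"
        then have "z \<in> E" using that by blast
        then obtain j where "j \<in> {1..K}" "cat z = \<eta> j" using funcset_mem[OF cat] by blast
        with z \<open>z \<in> E\<close> show "z \<in> (\<Union>j\<in>{1..K}. Z \<inter> ?E j)"
          unfolding category_class_def by blast
      qed blast
      moreover have "card (\<Union>j\<in>{1..K}. Z \<inter> ?E j) = (\<Sum>j\<in>{1..K}. card (Z \<inter> ?E j))"
      proof (rule card_UN_disjoint)
        show "\<forall>i\<in>{1..K}. finite (Z \<inter> ?E i)"
          using finite_subset[OF that fin] by simp
        show "\<forall>i\<in>{1..K}. \<forall>j\<in>{1..K}. i \<noteq> j \<longrightarrow> (Z \<inter> ?E i) \<inter> (Z \<inter> ?E j) = {}"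
          using disj by blast
      qed simp
      ultimately show ?thesis by (rule arg_cong[where f = card, THEN trans])
    qed
    have XE: "X \<subseteq> E" and YE: "Y \<subseteq> E"
      using X Y by (auto simp: partition_indep_def)
    have finX: "finite X"
      using XE fin by (rule finite_subset)
    obtain j where j: "j \<in> {1..K}" and lt: "card (X \<inter> ?E j) < card (Y \<inter> ?E j)"
    proof -
      have "\<not> (\<forall>i\<in>{1..K}. card (Y \<inter> ?E i) \<le> card (X \<inter> ?E i))"
      proof
        assume "\<forall>i\<in>{1..K}. card (Y \<inter> ?E i) \<le> card (X \<inter> ?E i)"
        then have "(\<Sum>i\<in>{1..K}. card (Y \<inter> ?E i)) \<le> (\<Sum>i\<in>{1..K}. card (X \<inter> ?E i))"
          by (intro sum_mono) blast
        with less split[OF XE] split[OF YE] show False by linarith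
      qed
      then show thesis
        using that by (meson not_le)
    qed
    have "\<not> Y \<inter> ?E j \<subseteq> X \<inter> ?E j"
      using lt finX by (meson card_mono finite_Int not_le)
    then obtain e where e: "e \<in> Y" "e \<in> ?E j" "e \<notin> X" by blast
    have "card (insert e X \<inter> ?E i) \<le> u i" if i: "i \<in> {1..K}" for i
    proof (cases "i = j")
      case True
      have "insert e X \<inter> ?E j = insert e (X \<inter> ?E j)" using e by blast
      then have "card (insert e X \<inter> ?E j) = Suc (card (X \<inter> ?E j))" using e finX by simp
      also have "\<dots> \<le> card (Y \<inter> ?E j)" using lt by simp
      also have "\<dots> \<le> u j" using Y j by (simp add: partition_indep_def)
      finally show ?thesis using True by simp
    next
      case False
      then have "insert e X \<inter> ?E i = X \<inter> ?E i" using disj[OF i j] e by blast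
      then show ?thesis using X i by (simp add: partition_indep_def)
    qed
    then have "insert e X \<in> partition_indep E K \<eta> cat u"
      using e XE YE by (auto simp: partition_indep_def)
    with e show ?thesis by blast
  qed
qed

section \<open>Minimization problems\<close>

record 's min_problem =
  feasible :: "'s set"
  objective :: "'s \<Rightarrow> nat"

definition optimal_solutions :: "'s min_problem \<Rightarrow> 's set" where
  "optimal_solutions P =
     {x \<in> feasible P. \<forall>y\<in>feasible P. objective P x \<le> objective P y}"

definition constrained_basis_problem ::
    "'a set \<Rightarrow> 'a set set \<Rightarrow> ('a \<Rightarrow> nat) \<Rightarrow> nat \<Rightarrow> (nat \<Rightarrow> 'c) \<Rightarrow> ('a \<Rightarrow> 'c) \<Rightarrow> (nat \<Rightarrow> nat)
      \<Rightarrow> 'a set min_problem" where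
  "constrained_basis_problem E \<I> w K \<eta> cat u =
     \<lparr>feasible = {B \<in> bases \<I>. \<forall>i\<in>{1..K}. category_count_min E K \<eta> cat B i \<le> u (K - i + 1)},
      objective = (\<lambda>B. \<Sum>e\<in>B. w e)\<rparr>"

definition matroid_intersection_problem ::
    "'a set set \<Rightarrow> 'a set set \<Rightarrow> ('a \<Rightarrow> nat) \<Rightarrow> 'a set min_problem" where
  "matroid_intersection_problem \<I> \<J> w =
     \<lparr>feasible = {I \<in> \<I> \<inter> \<J>. card I = Max {card J | J. J \<in> \<I> \<inter> \<J>}},
      objective = (\<lambda>I. \<Sum>e\<in>I. w e)\<rparr>"

end

theory Submission
  imports Defs
begin

text \<open>A basis respecting the bounds is a common independent set of cardinality \<open>r\<close>. No
  independent set of \<open>\<M>\<^sub>1\<close> is larger, and those of cardinality \<open>r\<close> are exactly its bases. So as soon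
  as one such basis exists, the maximum cardinality in (B) is \<open>r\<close> and the feasible sets agree; if
  none exists, no common independent set attains \<open>r\<close>.\<close>

context matroid
begin

lemma card_indep_le_rank: "X \<in> indep \<Longrightarrow> card X \<le> matroid_rank indep"
  using bases_nonempty card_indep_le_basis card_basis by fastforce

text \<open>Turns maximality under inclusion into a count: a finite independent superset of
  \<open>X\<close> has at most rank many elements, so once \<open>X\<close> has that many, the
  superset coincides with \<open>X\<close>.\<close>

lemma basis_iff_card_eq_rank:
  "X \<in> bases indep \<longleftrightarrow> X \<in> indep \<and> card X = matroid_rank indep"
proof (intro iffI conjI)
  assume "X \<in> indep \<and> card X = matroid_rank indep"
  then have X: "X \<in> indep" "card X = matroid_rank indep" by auto
  have "Y = X" if "Y \<in> indep" "X \<subseteq> Y" for Y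
    using card_seteq[OF finite_of_indep[OF that(1)] that(2)] card_indep_le_rank[OF that(1)] X(2)
    by simp
  with X(1) show "X \<in> bases indep"
    by (auto simp: bases_def)
qed (auto simp: card_basis bases_def)

text \<open>The family \<open>\<J>\<close> is kept abstract: the rank bounds the cardinality of
  every member of \<open>indep\<close>, so a single basis in \<open>\<J>\<close> already fixes the
  maximum.\<close>

lemma max_common_indep_eq_bases:
  assumes "bases indep \<inter> \<J> \<noteq> {}"
  shows "{I \<in> indep \<inter> \<J>. card I = Max {card J | J. J \<in> indep \<inter> \<J>}} = bases indep \<inter> \<J>"
proof -
  have "Max {card J | J. J \<in> indep \<inter> \<J>} = matroid_rank indep"
  proof (rule Max_eqI)
    show "finite {card J | J. J \<in> indep \<inter> \<J>}"
      using finite_indep by simp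
    show "matroid_rank indep \<in> {card J | J. J \<in> indep \<inter> \<J>}"
      \<comment> \<open>The rank is attained by the basis in \<open>\<J>\<close> that the assumption
        provides.\<close>
      using assms by (force simp: basis_iff_card_eq_rank)
  qed (auto intro: card_indep_le_rank)
  then show ?thesis
    by (auto simp: basis_iff_card_eq_rank)
qed

text \<open>Reversing the indices by i \<mapsto> K - i + 1 permutes {1..K}, and (A) reverses the
  counts and the bounds alike, so its constraints are those of the partition matroid in another
  order.\<close>

lemma feasible_constrained_basis_problem:
  "feasible (constrained_basis_problem E indep w K \<eta> cat u)
     = bases indep \<inter> partition_indep E K \<eta> cat u"
proof -
  have reindex: "(\<forall>i\<in>{1..K}. P (K - i + 1)) \<longleftrightarrow> (\<forall>j\<in>{1..K}. P j)" for P :: "nat \<Rightarrow> bool"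
  proof (intro iffI ballI)
    fix j assume P: "\<forall>i\<in>{1..K}. P (K - i + 1)" and j: "j \<in> {1..K}"
    \<comment> \<open>The reversal is its own inverse, so the instance for \<open>j\<close> is the
      one at index \<open>K - j + 1\<close>; with 1 \<le> j \<le> K no subtraction is
      truncated.\<close>
    then have "P (K - (K - j + 1) + 1)"
      by (intro bspec[OF P]) auto
    moreover have "K - (K - j + 1) + 1 = j" using j by auto
    ultimately show "P j" by simp
  qed auto
  have "B \<subseteq> E" if "B \<in> bases indep" for B
    using that indep_subset by (auto simp: bases_def)
  then show ?thesis
    unfolding constrained_basis_problem_def partition_indep_def category_count_min_def
    using reindex[of "\<lambda>j. category_count E \<eta> cat _ j \<le> u j"]
    by (auto simp: category_count_def)
qed

end

theorem theorem14:
  fixes E :: "'a set" and \<I>\<^sub>1 :: "'a set set" and w :: "'a \<Rightarrow> nat"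
    and K r :: nat and \<eta> :: "nat \<Rightarrow> 'c" and cat :: "'a \<Rightarrow> 'c" and u :: "nat \<Rightarrow> nat"
    and A B :: "'a set min_problem"
  assumes "matroid E \<I>\<^sub>1"
    and "matroid_rank \<I>\<^sub>1 = r"
    and "inj_on \<eta> {1..K}"
    and "cat \<in> E \<rightarrow> \<eta> ` {1..K}"
  defines "A \<equiv> constrained_basis_problem E \<I>\<^sub>1 w K \<eta> cat u"
    and "B \<equiv> matroid_intersection_problem \<I>\<^sub>1 (partition_indep E K \<eta> cat u) w"
  shows "(feasible A \<noteq> {} \<longrightarrow>
            feasible A = feasible B \<and> objective A = objective B \<and>
            optimal_solutions A = optimal_solutions B) \<and>
         (feasible A = {} \<longrightarrow> (\<forall>B\<^sub>o\<^sub>p\<^sub>t \<in> optimal_solutions B. card B\<^sub>o\<^sub>p\<^sub>t < r))"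
proof -
  interpret matroid E \<I>\<^sub>1 by fact
  let ?\<J> = "partition_indep E K \<eta> cat u"
  have feasible_A: "feasible A = bases \<I>\<^sub>1 \<inter> ?\<J>"
    unfolding A_def by (rule feasible_constrained_basis_problem)
  have feasible_B: "feasible B = {I \<in> \<I>\<^sub>1 \<inter> ?\<J>. card I = Max {card J | J. J \<in> \<I>\<^sub>1 \<inter> ?\<J>}}"
    by (simp add: B_def matroid_intersection_problem_def)
  have objective: "objective A = objective B"
    by (simp add: A_def B_def constrained_basis_problem_def matroid_intersection_problem_def)
  have "feasible A = feasible B" if "feasible A \<noteq> {}"
    using max_common_indep_eq_bases[of ?\<J>] that by (simp add: feasible_A feasible_B)
  moreover have "card X < r" if "feasible A = {}" "X \<in> optimal_solutions B" for X
  proof -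
    have X: "X \<in> \<I>\<^sub>1 \<inter> ?\<J>"
      using that(2) by (simp add: optimal_solutions_def feasible_B)
    \<comment> \<open>A common independent set of full rank would be a basis within the bounds,
      hence feasible for (A).\<close>
    with that(1) have "card X \<noteq> matroid_rank \<I>\<^sub>1"
      by (auto simp: feasible_A basis_iff_card_eq_rank)
    with X show ?thesis
      using card_indep_le_rank[of X] assms(2) by simp
  qed
  \<comment> \<open>Optimal solutions depend only on the feasible set and the objective, so they
    agree as soon as these do.\<close>
  ultimately show ?thesis
    using objective by (simp add: optimal_solutions_def)
qed

end
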